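(* Let $K$ be a field of characteristic different from $2$ and $\psi:K\times K\to K$ a function with $\psi(x,y)=\psi(y,x)$ and $\psi(x+z,y+z)=\psi(x,y)$ for all $x,y,z\in K$. For $m\ge 0$ and $y_1,\ldots,y_{2m}\in K$ let $pf_{2m}(y_1,\ldots,y_{2m})$ denote the Pfaffian of the triangular array $(\psi(y_i,y_j))_{1\le i<j\le 2m}$ (with $pf_0=1$). Then for every $n\ge 1$, all $x_1,\ldots,x_{2n}\in K$ and every $1\le s\le 2n$, $$pf_{2n}(x_1,\ldots,x_{s-1},x_s,x_s,x_{s+2},\ldots,x_{2n})=c\; pf_{2n-2}(x_1,\ldots,x_{s-1},x_{s+2},\ldots,x_{2n}),$$ where $c=\psi(0,0)$; i.e. if the $(s+1)$-st argument equals the $s$-th, the Pfaffian equals $c$ times the Pfaffian of the remaining $2n-2$ arguments (in their original order). Here indices are cyclic: $x_{2n+1}=x_1$, so for $s=2n$ the statement concerns setting $x_1=x_{2n}$ and removing the arguments in positions $1$ and $2n$.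
   Context: For a triangular array $\bar A=(a_{i,j})_{1\le i<j\le 2m}$ its Pfaffian is $pf_{2m}\bar A=\sum_{\pi}\operatorname{sign}(\pi)\,a_{i_1,j_1}\cdots a_{i_m,j_m}$, the sum over all permutations $\pi\in S_{2m}$ with one-line notation $(i_1,j_1,\ldots,i_m,j_m)$ satisfying $i_1<i_2<\cdots<i_m$ and $i_s<j_s$ for all $s$; $\operatorname{sign}(\pi)$ is the sign of the permutation. *)

theory Defs
  imports Main "HOL-Combinatorics.Permutations"
begin

text \<open>
  A triangular array is a function on index pairs, of which only the entries
  \<open>a i j\<close> with \<open>1 \<le> i < j \<le> 2 * m\<close> are used.  A permutation with one-line notation
  \<open>(i\<^sub>1, j\<^sub>1, \<dots>, i\<^sub>m, j\<^sub>m)\<close> has \<open>i\<^sub>k = p (2 * k - 1)\<close> and \<open>j\<^sub>k = p (2 * k)\<close>.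
\<close>

definition pfaffian_perms :: "nat \<Rightarrow> (nat \<Rightarrow> nat) set" where
  "pfaffian_perms m = {p. p permutes {1..2 * m}
     \<and> strict_mono_on {1..m} (\<lambda>k. p (2 * k - 1))
     \<and> (\<forall>k\<in>{1..m}. p (2 * k - 1) < p (2 * k))}"

definition pfaffian :: "nat \<Rightarrow> (nat \<Rightarrow> nat \<Rightarrow> 'a::comm_ring_1) \<Rightarrow> 'a" where
  "pfaffian m a =
     (\<Sum>p\<in>pfaffian_perms m. of_int (sign p) * (\<Prod>k=1..m. a (p (2 * k - 1)) (p (2 * k))))"

text \<open>
  The argument tuple \<open>(y\<^sub>1, \<dots>, y\<^bsub>2m\<^esub>)\<close> is a list of even length \<open>2 * m\<close>.  List positions
  start at 0, so \<open>y\<^sub>i\<close> is \<open>ys ! (i - 1)\<close>.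
\<close>

definition pf :: "('b \<Rightarrow> 'b \<Rightarrow> 'a::comm_ring_1) \<Rightarrow> 'b list \<Rightarrow> 'a" where
  "pf \<psi> ys = pfaffian (length ys div 2) (\<lambda>i j. \<psi> (ys ! (i - 1)) (ys ! (j - 1)))"

lemma pf_Nil: "pf \<psi> [] = 1"
proof -
  have "pfaffian_perms 0 = {id}"
    by (auto simp: pfaffian_perms_def strict_mono_on_def)
  then show ?thesis
    by (simp add: pf_def pfaffian_def sign_id)
qed

end

theory Submission
  imports Defs
begin

text \<open>
  Extend the array to an antisymmetric one.  Each term of the Pfaffian then depends only on the
  perfect matching \<open>{{i\<^sub>1, j\<^sub>1}, \<dots>, {i\<^sub>m, j\<^sub>m}}\<close>, so the sum may be reindexed by any permutation of the
  points.  Off the positions \<open>s, t\<close> of the two equal arguments, row \<open>t\<close> is \<open>\<epsilon>\<close> times row \<open>s\<close>, where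
  \<open>\<epsilon> = 1\<close> for adjacent positions and \<open>\<epsilon> = -1\<close> for the first and last position.  Exchanging \<open>s\<close> and
  \<open>t\<close> in a matching that does not pair them changes the product by \<open>\<epsilon>\<^sup>2 = 1\<close> and the sign by \<open>-1\<close>, so
  these matchings contribute a sum \<open>S = -S\<close>, which is zero as the characteristic is not 2.  The
  matchings that pair \<open>s\<close> and \<open>t\<close> are carried to those that pair the last two points by a
  permutation that keeps the order of the other points; it is even because \<open>s + t\<close> is odd.
\<close>

declare One_nat_def [simp del]

section \<open>Matchings and the terms of the Pfaffian\<close>

text \<open>Keeps what survives reordering the pairs and flipping a pair;
  \<open>pfaffian_perms\<close> will turn out to contain exactly one representative of each
  matching.\<close>

definition matching :: "nat \<Rightarrow> (nat \<Rightarrow> 'b) \<Rightarrow> 'b set set" where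
  "matching m p = (\<lambda>k. {p (2 * k - 1), p (2 * k)}) ` {1..m}"

text \<open>Makes sense for every \<open>p\<close>, because composites such as
  \<open>transpose s t \<circ> p\<close> usually leave \<open>pfaffian_perms\<close>.\<close>

definition pf_term :: "nat \<Rightarrow> (nat \<Rightarrow> nat \<Rightarrow> 'a::comm_ring_1) \<Rightarrow> (nat \<Rightarrow> nat) \<Rightarrow> 'a" where
  "pf_term m a p = of_int (sign p) * (\<Prod>k=1..m. a (p (2 * k - 1)) (p (2 * k)))"

lemma pfaffian_eq_sum_pf_term: "pfaffian m a = (\<Sum>p\<in>pfaffian_perms m. pf_term m a p)"
  by (simp add: pfaffian_def pf_term_def)

lemma matching_comp: "matching m (f \<circ> p) = (`) f ` matching m p"
  by (auto simp: matching_def image_image)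

lemma image_mem_matching_comp_iff:
  "inj f \<Longrightarrow> f ` e \<in> matching m (f \<circ> p) \<longleftrightarrow> e \<in> matching m p"
  by (auto simp: matching_comp image_iff inj_image_eq_iff)

lemma pfaffian_perms_permutes: "p \<in> pfaffian_perms m \<Longrightarrow> p permutes {1..2 * m}"
  by (simp add: pfaffian_perms_def)

lemma finite_pfaffian_perms: "finite (pfaffian_perms m)"
  by (rule finite_subset[OF _ finite_permutations[of "{1..2 * m}"]])
     (auto simp: pfaffian_perms_def)

lemma sign_comp_permutes:
  assumes "p permutes S" "q permutes S" "finite S"
  shows "sign (p \<circ> q) = sign p * sign q"
  using assms by (intro sign_compose) (auto intro: permutes_imp_permutation)

lemma permutes_pairs_eq_iff:
  fixes i j :: nat
  assumes "p permutes S" "i \<ge> 1" "j \<ge> 1"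
  shows "p (2 * i - 1) = p (2 * j - 1) \<longleftrightarrow> i = j" "p (2 * i) = p (2 * j) \<longleftrightarrow> i = j"
    "p (2 * i - 1) \<noteq> p (2 * j)"
proof -
  note inj = inj_eq[OF permutes_inj[OF assms(1)]]
  show "p (2 * i - 1) = p (2 * j - 1) \<longleftrightarrow> i = j" "p (2 * i) = p (2 * j) \<longleftrightarrow> i = j"
    using assms(2,3) by (auto simp: inj)
  have "2 * i - 1 \<noteq> 2 * j" using assms(2,3) by presburger
  then show "p (2 * i - 1) \<noteq> p (2 * j)" by (simp add: inj)
qed

section \<open>Existence of a normal form\<close>

text \<open>The sign of the transposition cancels against the antisymmetry of \<open>a\<close>. The
  last conclusion tracks the first components for the minimization in
  \<open>ex_pfaffian_perm\<close>.\<close>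

lemma flip_pair:
  fixes a :: "nat \<Rightarrow> nat \<Rightarrow> 'a::comm_ring_1"
  assumes p: "p permutes {1..2 * m}"
    and anti: "\<And>i j. i \<noteq> j \<Longrightarrow> a i j = - a j i" and k: "k \<in> {1..m}"
  defines "q \<equiv> p \<circ> transpose (2 * k - 1) (2 * k)"
  shows "q permutes {1..2 * m}" "matching m q = matching m p" "pf_term m a q = pf_term m a p"
    "\<And>i. i \<ge> 1 \<Longrightarrow> q (2 * i - 1) = (if i = k then p (2 * k) else p (2 * i - 1))"
proof -
  have T: "transpose (2 * k - 1) (2 * k) permutes {1..2 * m}"
    using k by (intro permutes_swap_id) auto
  show "q permutes {1..2 * m}" unfolding q_def by (intro permutes_compose T p)
  show q1: "q (2 * i - 1) = (if i = k then p (2 * k) else p (2 * i - 1))" if "i \<ge> 1" for i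
  proof -
    have "2 * i - 1 \<noteq> 2 * k" using that by presburger
    then show ?thesis using that k by (auto simp: q_def transpose_def)
  qed
  have q2: "q (2 * i) = (if i = k then p (2 * k - 1) else p (2 * i))" if "i \<ge> 1" for i
  proof -
    have "2 * i \<noteq> 2 * k - 1" using that k by (auto; presburger)
    then show ?thesis using that k by (auto simp: q_def transpose_def)
  qed
  show "matching m q = matching m p"
    unfolding matching_def by (rule image_cong) (auto simp: q1 q2)
  have ne: "2 * k - 1 \<noteq> 2 * k" using k by auto
  have "sign q = - sign p"
    unfolding q_def using ne by (simp add: sign_comp_permutes[OF p T] sign_swap_id)
  moreover have "(\<Prod>i=1..m. a (q (2 * i - 1)) (q (2 * i))) =
      - (\<Prod>i=1..m. a (p (2 * i - 1)) (p (2 * i)))"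
  proof -
    have "(\<Prod>i=1..m. a (q (2 * i - 1)) (q (2 * i))) =
        a (p (2 * k)) (p (2 * k - 1)) * (\<Prod>i\<in>{1..m} - {k}. a (p (2 * i - 1)) (p (2 * i)))"
      using k by (subst prod.remove[of _ k])
        (auto simp: q1 q2 intro!: arg_cong2[where f = "(*)"] prod.cong)
    also have "a (p (2 * k)) (p (2 * k - 1)) = - a (p (2 * k - 1)) (p (2 * k))"
      using permutes_pairs_eq_iff(3)[OF p, of k k] k by (intro anti) auto
    finally show ?thesis using k by (subst prod.remove[of "{1..m}" k]) auto
  qed
  ultimately show "pf_term m a q = pf_term m a p" by (simp add: pf_term_def)
qed

text \<open>Exchanging two whole pairs is a product of two transpositions, hence even, and it merely
  permutes the factors of the product.\<close>

lemma swap_pairs: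
  fixes a :: "nat \<Rightarrow> nat \<Rightarrow> 'a::comm_ring_1"
  assumes p: "p permutes {1..2 * m}"
    and k: "k \<in> {1..m}" and l: "l \<in> {1..m}" and kl: "k \<noteq> l"
  defines "q \<equiv> p \<circ> (transpose (2 * k - 1) (2 * l - 1) \<circ> transpose (2 * k) (2 * l))"
  shows "q permutes {1..2 * m}" "matching m q = matching m p" "pf_term m a q = pf_term m a p"
    "\<And>i. i \<ge> 1 \<Longrightarrow> q (2 * i - 1) = p (2 * transpose k l i - 1)"
proof -
  have T: "transpose (2 * k - 1) (2 * l - 1) permutes {1..2 * m}"
      "transpose (2 * k) (2 * l) permutes {1..2 * m}"
    using k l by (auto intro!: permutes_swap_id)
  note T' = permutes_compose[OF T(2) T(1)]
  show "q permutes {1..2 * m}" unfolding q_def by (intro permutes_compose T p)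
  have kl': "2 * k - 1 \<noteq> 2 * l - 1" "2 * k \<noteq> 2 * l" using k l kl by auto
  show q1: "q (2 * i - 1) = p (2 * transpose k l i - 1)" if "i \<ge> 1" for i
  proof -
    have "2 * i - 1 \<noteq> 2 * k" "2 * i - 1 \<noteq> 2 * l" using that by presburger+
    then show ?thesis using that k l by (auto simp: q_def transpose_def)
  qed
  have q2: "q (2 * i) = p (2 * transpose k l i)" if "i \<ge> 1" for i
  proof -
    have "2 * j \<noteq> 2 * k - 1" "2 * j \<noteq> 2 * l - 1" for j
      using that k l by (auto; presburger)+
    then show ?thesis using that k l by (auto simp: q_def transpose_def)
  qed
  \<comment> \<open>On pair indices \<open>q\<close> is \<open>p\<close> reindexed by
    \<open>transpose k l\<close>; this permutes both the edges of the matching and the factors of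
    the term.\<close>
  have tr: "transpose k l permutes {1..m}" using k l by (intro permutes_swap_id)
  have "matching m q = (\<lambda>i. {p (2 * i - 1), p (2 * i)}) ` transpose k l ` {1..m}"
    unfolding matching_def image_image by (rule image_cong) (auto simp: q1 q2)
  then show "matching m q = matching m p"
    by (simp add: permutes_image[OF tr] matching_def)
  have "sign q = sign p"
    unfolding q_def using kl'
    by (simp add: sign_comp_permutes[OF p T'] sign_comp_permutes[OF T] sign_swap_id)
  moreover have "(\<Prod>i=1..m. a (q (2 * i - 1)) (q (2 * i))) =
      (\<Prod>i=1..m. a (p (2 * i - 1)) (p (2 * i)))"
    by (subst prod.permute[OF tr]) (auto simp: q1 q2 intro!: prod.cong)
  ultimately show "pf_term m a q = pf_term m a p" by (simp add: pf_term_def)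
qed

text \<open>
  A rearrangement of the pairs is in normal form once it minimizes the sum of the first
  components with positive, strictly decreasing weights.
\<close>

lemma ex_pfaffian_perm:
  fixes a :: "nat \<Rightarrow> nat \<Rightarrow> 'a::comm_ring_1"
  assumes p: "p permutes {1..2 * m}"
    and anti: "\<And>i j. i \<noteq> j \<Longrightarrow> a i j = - a j i"
  shows "\<exists>q\<in>pfaffian_perms m. matching m q = matching m p \<and> pf_term m a q = pf_term m a p"
proof -
  define P where "P q \<longleftrightarrow> q permutes {1..2 * m} \<and> matching m q = matching m p \<and>
    pf_term m a q = pf_term m a p" for q
  define \<mu> where "\<mu> q = (\<Sum>k=1..m. (m + 1 - k) * q (2 * k - 1))" for q :: "nat \<Rightarrow> nat"
  have "P p" using p by (simp add: P_def)
  then obtain q where "P q" and min: "\<And>r. P r \<Longrightarrow> \<mu> q \<le> \<mu> r"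
    using ex_has_least_nat[of P p \<mu>] by blast
  then have q: "q permutes {1..2 * m}" "matching m q = matching m p" "pf_term m a q = pf_term m a p"
    by (auto simp: P_def)
  have lt: "q (2 * k - 1) < q (2 * k)" if k: "k \<in> {1..m}" for k
  proof (rule ccontr)
    assume "\<not> ?thesis"
    then have less: "q (2 * k) < q (2 * k - 1)"
      using permutes_pairs_eq_iff(3)[OF q(1), of k k] k by auto
    define r where "r = q \<circ> transpose (2 * k - 1) (2 * k)"
    note r = flip_pair[where a = a, OF q(1) anti k, folded r_def]
    have "P r" using r q by (simp add: P_def)
    moreover have "\<mu> r < \<mu> q"
      unfolding \<mu>_def
    \<comment> \<open>Only the summand at \<open>k\<close> changes: its value drops and its weight
      \<open>m + 1 - k\<close> is positive.\<close>
    proof (rule sum_strict_mono_ex1)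
      show "\<forall>i\<in>{1..m}. (m + 1 - i) * r (2 * i - 1) \<le> (m + 1 - i) * q (2 * i - 1)"
        using less by (auto simp: r(4) intro!: mult_le_mono)
      show "\<exists>i\<in>{1..m}. (m + 1 - i) * r (2 * i - 1) < (m + 1 - i) * q (2 * i - 1)"
        using less k by (intro bexI[of _ k]) (auto simp: r(4))
    qed auto
    ultimately show False using min by fastforce
  qed
  have "q (2 * k - 1) < q (2 * l - 1)" if k: "k \<in> {1..m}" and l: "l \<in> {1..m}" and kl: "k < l" for k l
  proof (rule ccontr)
    assume "\<not> ?thesis"
    then have less: "q (2 * l - 1) < q (2 * k - 1)"
      using permutes_pairs_eq_iff(1)[OF q(1), of k l] k l kl by auto
    define r where "r = q \<circ> (transpose (2 * k - 1) (2 * l - 1) \<circ> transpose (2 * k) (2 * l))"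
    have "k \<noteq> l" using kl by simp
    note r = swap_pairs[OF q(1) k l this, folded r_def]
    have "P r" using r(1,2) r(3)[of a] q by (simp add: P_def)
    moreover have "\<mu> r < \<mu> q"
    proof -
      have split: "\<mu> f = (m + 1 - k) * f (2 * k - 1) + ((m + 1 - l) * f (2 * l - 1) +
          (\<Sum>i\<in>{1..m} - {k} - {l}. (m + 1 - i) * f (2 * i - 1)))" for f
        unfolding \<mu>_def using k l kl
        by (subst sum.remove[of _ k]; simp; subst sum.remove[of _ l]; simp)
      have rest: "(\<Sum>i\<in>{1..m} - {k} - {l}. (m + 1 - i) * r (2 * i - 1)) =
          (\<Sum>i\<in>{1..m} - {k} - {l}. (m + 1 - i) * q (2 * i - 1))"
        by (rule sum.cong) (auto simp: r(4) transpose_def)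
      have "r (2 * k - 1) = q (2 * l - 1)" "r (2 * l - 1) = q (2 * k - 1)"
        using k l by (auto simp: r(4))
      \<comment> \<open>Rearrangement inequality: the weights differ by \<open>Suc d\<close> and the
        first components by \<open>Suc e\<close>, so the exchange lowers \<open>\<mu>\<close> by
        \<open>Suc d * Suc e\<close>.\<close>
      moreover obtain d where d: "m + 1 - k = (m + 1 - l) + Suc d"
        using k l kl that by (metis add_Suc_right atLeastAtMost_iff diff_less_mono2 le_imp_less_Suc less_imp_Suc_add order_less_le_trans Suc_eq_plus1)
      moreover obtain e where "q (2 * k - 1) = q (2 * l - 1) + Suc e"
        using less less_imp_Suc_add by fastforce
      ultimately show ?thesis
        unfolding split rest by (simp only: d) (simp add: algebra_simps)
    qed
    ultimately show False using min by fastforce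
  qed
  then have "q \<in> pfaffian_perms m"
    using q(1) lt by (auto simp: pfaffian_perms_def strict_mono_on_def)
  then show ?thesis using q by blast
qed

section \<open>Uniqueness of the normal form\<close>

text \<open>Both lists are sorted and distinct with the same elements. Hence an increasing
  enumeration is determined by its image; the same fact later identifies the list of remaining
  arguments.\<close>

lemma map_upt_eq_sorted_list_of_set:
  fixes h :: "nat \<Rightarrow> nat"
  assumes h: "strict_mono_on {1..m} h"
  shows "map h [1..<m + 1] = sorted_list_of_set (h ` {1..m})"
proof (rule sorted_distinct_set_unique)
  show "sorted (map h [1..<m + 1])"
    unfolding sorted_iff_nth_mono
    by (auto intro!: strict_mono_on_leD[OF h] simp del: upt_Suc)
  have S: "set [1..<m + 1] = {1..m}" by auto
  then show "distinct (map h [1..<m + 1])"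
    using strict_mono_on_imp_inj_on[OF h] by (simp only: distinct_map distinct_upt simp_thms)
  show "set (map h [1..<m + 1]) = set (sorted_list_of_set (h ` {1..m}))"
    by (simp only: set_map S set_sorted_list_of_set finite_imageI finite_atLeastAtMost)
qed auto

lemma strict_mono_on_same_image:
  fixes f g :: "nat \<Rightarrow> nat"
  assumes "strict_mono_on {1..m} f" "strict_mono_on {1..m} g" "f ` {1..m} = g ` {1..m}"
    and "k \<in> {1..m}"
  shows "f k = g k"
proof -
  have "map f [1..<m + 1] = map g [1..<m + 1]"
    by (simp only: assms(1-3) map_upt_eq_sorted_list_of_set)
  then have "\<forall>k\<in>set [1..<m + 1]. f k = g k" by (simp only: map_eq_conv)
  then show ?thesis using assms(4) by simp
qed

text \<open>In normal form the first components are the minima of the edges, listed increasingly, so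
  the matching determines them; each second component is the maximum of the only edge with the given
  minimum.\<close>

lemma matching_inj_pfaffian_perms:
  assumes p: "p \<in> pfaffian_perms m" and q: "q \<in> pfaffian_perms m"
    and eq: "matching m p = matching m q"
  shows "p = q"
proof -
  have mins: "(\<lambda>k. r (2 * k - 1)) ` {1..m} = Min ` matching m r" if "r \<in> pfaffian_perms m" for r
    unfolding matching_def image_image
    by (rule image_cong) (use that in \<open>auto simp: pfaffian_perms_def min_def dest: bspec\<close>)
  \<comment> \<open>The left side mentions only the matching and the first component, so it agrees
    for \<open>p\<close> and \<open>q\<close> once those do.\<close>
  have maxs: "Max ` {e \<in> matching m r. Min e = r (2 * k - 1)} = {r (2 * k)}"
    if r: "r \<in> pfaffian_perms m" and k: "k \<in> {1..m}" for r k
  proof -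
    have lt: "r (2 * i - 1) < r (2 * i)" if "i \<in> {1..m}" for i
      using r that by (auto simp: pfaffian_perms_def)
    have "{e \<in> matching m r. Min e = r (2 * k - 1)} = {{r (2 * k - 1), r (2 * k)}}"
    proof (intro equalityI subsetI)
      fix e assume "e \<in> {e \<in> matching m r. Min e = r (2 * k - 1)}"
      then obtain i where i: "i \<in> {1..m}" "e = {r (2 * i - 1), r (2 * i)}" "Min e = r (2 * k - 1)"
        by (auto simp: matching_def)
      then have "i = k"
        using lt[of i] k permutes_pairs_eq_iff(1)[OF pfaffian_perms_permutes[OF r], of i k] by simp
      then show "e \<in> {{r (2 * k - 1), r (2 * k)}}" using i by simp
    qed (use k lt[OF k] in \<open>auto simp: matching_def\<close>)
    then show ?thesis using lt[OF k] by simp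
  qed
  have odd: "p (2 * k - 1) = q (2 * k - 1)" if "k \<in> {1..m}" for k
    using strict_mono_on_same_image[of m "\<lambda>k. p (2 * k - 1)" "\<lambda>k. q (2 * k - 1)" k]
      p q mins[OF p] mins[OF q] eq that by (simp add: pfaffian_perms_def)
  have even: "p (2 * k) = q (2 * k)" if "k \<in> {1..m}" for k
    using maxs[OF p that] maxs[OF q that] odd[OF that] eq by simp
  show ?thesis
  proof
    fix i
    show "p i = q i"
    proof (cases "i \<in> {1..2 * m}")
      case True
      \<comment> \<open>\<open>(i + 1) div 2\<close> is the index of the pair that occupies position
        \<open>i\<close>.\<close>
      then have "(i + 1) div 2 \<in> {1..m}" "i = 2 * ((i + 1) div 2) - 1 \<or> i = 2 * ((i + 1) div 2)"
        by (simp_all; presburger)+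
      then show ?thesis using odd even by metis
    next
      case False
      then show ?thesis
        using permutes_not_in[OF pfaffian_perms_permutes[OF p]]
          permutes_not_in[OF pfaffian_perms_permutes[OF q]] by simp
    qed
  qed
qed

section \<open>Reindexing sums over matchings\<close>

text \<open>Passing to normal forms changes neither matching nor term, and by uniqueness the two
  normal forms coincide.\<close>

lemma pf_term_cong_matching:
  fixes a :: "nat \<Rightarrow> nat \<Rightarrow> 'a::comm_ring_1"
  assumes "\<And>i j. i \<noteq> j \<Longrightarrow> a i j = - a j i"
    and "p permutes {1..2 * m}" "q permutes {1..2 * m}" "matching m p = matching m q"
  shows "pf_term m a p = pf_term m a q"
  using ex_pfaffian_perm[of p m a] ex_pfaffian_perm[of q m a] assms matching_inj_pfaffian_perms
  by metis

text \<open>Composing with \<open>\<sigma>\<close> and renormalizing is a bijection of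
  \<open>pfaffian_perms m\<close>, whose inverse uses \<open>inv \<sigma>\<close>; \<open>F\<close>
  does not see the renormalization.\<close>

lemma sum_pfaffian_perms_comp:
  fixes F :: "(nat \<Rightarrow> nat) \<Rightarrow> 'a::comm_monoid_add"
  assumes \<sigma>: "\<sigma> permutes {1..2 * m}"
    and F: "\<And>p q. p permutes {1..2 * m} \<Longrightarrow> q permutes {1..2 * m} \<Longrightarrow>
      matching m p = matching m q \<Longrightarrow> F p = F q"
  shows "(\<Sum>p\<in>pfaffian_perms m. F (\<sigma> \<circ> p)) = (\<Sum>p\<in>pfaffian_perms m. F p)"
proof -
  have "\<exists>q\<in>pfaffian_perms m. matching m q = matching m p" if "p permutes {1..2 * m}" for p
    \<comment> \<open>Only the matching matters here, so the zero array serves as the antisymmetric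
      one.\<close>
    using ex_pfaffian_perm[OF that, of "\<lambda>_ _. 0 :: int"] by auto
  then obtain \<nu> where \<nu>: "\<And>p. p permutes {1..2 * m} \<Longrightarrow> \<nu> p \<in> pfaffian_perms m"
      "\<And>p. p permutes {1..2 * m} \<Longrightarrow> matching m (\<nu> p) = matching m p"
    by metis
  have comp: "\<tau> \<circ> p permutes {1..2 * m}" if "\<tau> permutes {1..2 * m}" "p \<in> pfaffian_perms m" for \<tau> p
    by (rule permutes_compose[OF pfaffian_perms_permutes]) (use that in auto)
  have inv: "\<nu> (\<rho> \<circ> \<nu> (\<tau> \<circ> p)) = p"
    if "\<rho> \<circ> \<tau> = id" "\<tau> permutes {1..2 * m}" "\<rho> permutes {1..2 * m}" "p \<in> pfaffian_perms m" for \<rho> \<tau> p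
  proof (rule matching_inj_pfaffian_perms)
    have "matching m (\<nu> (\<rho> \<circ> \<nu> (\<tau> \<circ> p))) = matching m (\<rho> \<circ> (\<tau> \<circ> p))"
      using that by (simp add: \<nu> comp matching_comp)
    also have "\<rho> \<circ> (\<tau> \<circ> p) = p" using that(1) by (simp flip: comp_assoc)
    finally show "matching m (\<nu> (\<rho> \<circ> \<nu> (\<tau> \<circ> p))) = matching m p" .
  qed (use that in \<open>simp_all add: \<nu> comp\<close>)
  note \<sigma>' = permutes_inv[OF \<sigma>]
  show ?thesis
  proof (rule sum.reindex_bij_witness[where j = "\<lambda>p. \<nu> (\<sigma> \<circ> p)" and i = "\<lambda>p. \<nu> (inv \<sigma> \<circ> p)"])
    fix p assume p: "p \<in> pfaffian_perms m"
    show "\<nu> (inv \<sigma> \<circ> \<nu> (\<sigma> \<circ> p)) = p"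
      by (rule inv) (use \<sigma> \<sigma>' p in \<open>auto simp: permutes_inv_o\<close>)
    show "\<nu> (\<sigma> \<circ> \<nu> (inv \<sigma> \<circ> p)) = p"
      by (rule inv) (use \<sigma> \<sigma>' p in \<open>auto simp: permutes_inv_o\<close>)
    show "\<nu> (\<sigma> \<circ> p) \<in> pfaffian_perms m" "\<nu> (inv \<sigma> \<circ> p) \<in> pfaffian_perms m"
      using \<sigma> \<sigma>' p by (simp_all add: \<nu> comp)
    show "F (\<nu> (\<sigma> \<circ> p)) = F (\<sigma> \<circ> p)"
      using \<sigma> p by (intro F) (simp_all add: \<nu> comp pfaffian_perms_permutes)
  qed
qed

section \<open>Exchanging two proportional rows\<close>

lemma prod_pairs:
  fixes f :: "nat \<Rightarrow> 'a::comm_monoid_mult"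
  shows "(\<Prod>k=1..m. f (2 * k - 1) * f (2 * k)) = (\<Prod>i=1..2 * m. f i)"
  by (induction m) (simp_all add: mult.assoc)

text \<open>Each entry acquires one factor \<epsilon> for every endpoint in \<open>{s, t}\<close>.
  Both points occur once in the matching, so the factors multiply to
  \<open>\<epsilon> * \<epsilon> = 1\<close> and only the sign of the transposition remains.\<close>

lemma pf_term_transpose:
  fixes a :: "nat \<Rightarrow> nat \<Rightarrow> 'a::comm_ring_1"
  assumes anti: "\<And>i j. i \<noteq> j \<Longrightarrow> a i j = - a j i"
    and \<epsilon>: "\<epsilon> * \<epsilon> = 1"
    and a: "\<And>j. j \<in> {1..2 * m} - {s, t} \<Longrightarrow> a t j = \<epsilon> * a s j"
    and st: "s \<in> {1..2 * m}" "t \<in> {1..2 * m}" "s \<noteq> t"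
    and p: "p permutes {1..2 * m}" and nm: "{s, t} \<notin> matching m p"
  shows "pf_term m a (transpose s t \<circ> p) = - pf_term m a p"
proof -
  \<comment> \<open>A weight per point, so that the product over pairs can be regrouped by
    \<open>prod_pairs\<close> into a product over points.\<close>
  define \<eta> where "\<eta> i = (if i = s \<or> i = t then \<epsilon> else 1)" for i
  let ?T = "transpose s t"
  have a': "a s j = \<epsilon> * a t j" if "j \<in> {1..2 * m} - {s, t}" for j
    using a[OF that] \<epsilon> by (simp flip: mult.assoc)
  have b: "a j t = \<epsilon> * a j s" if "j \<in> {1..2 * m} - {s, t}" for j
    using a[OF that] anti[of j t] anti[of j s] that by simp
  have b': "a j s = \<epsilon> * a j t" if "j \<in> {1..2 * m} - {s, t}" for j
    using a'[OF that] anti[of j t] anti[of j s] that by simp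
  \<comment> \<open>The pair \<open>{s, t}\<close> must be left out: there the exchange negates the
    entry, while \<open>\<eta> s * \<eta> t = 1\<close>.\<close>
  have key: "a (?T i) (?T j) = \<eta> i * \<eta> j * a i j"
    if "i \<in> {1..2 * m}" "j \<in> {1..2 * m}" "{i, j} \<noteq> {s, t}" "i \<noteq> j" for i j
  proof -
    have "\<not> (i \<in> {s, t} \<and> j \<in> {s, t})"
      using that(3,4) by (auto simp: insert_commute)
    then consider "i \<notin> {s, t}" "j \<notin> {s, t}" | "i = s" "j \<notin> {s, t}" | "i = t" "j \<notin> {s, t}"
      | "i \<notin> {s, t}" "j = s" | "i \<notin> {s, t}" "j = t"
      by blast
    then show ?thesis
      by cases (use that(1,2) st(3) a[of j] a'[of j] b[of i] b'[of i] in \<open>simp_all add: \<eta>_def\<close>)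
  qed
  have "(\<Prod>k=1..m. a (?T (p (2 * k - 1))) (?T (p (2 * k)))) =
      (\<Prod>k=1..m. \<eta> (p (2 * k - 1)) * \<eta> (p (2 * k)) * a (p (2 * k - 1)) (p (2 * k)))"
  proof (rule prod.cong[OF refl], rule key)
    fix k assume k: "k \<in> {1..m}"
    then show "p (2 * k - 1) \<in> {1..2 * m}" "p (2 * k) \<in> {1..2 * m}"
      by (auto simp only: permutes_in_image[OF p]) auto
    show "{p (2 * k - 1), p (2 * k)} \<noteq> {s, t}"
      using nm k by (auto simp: matching_def image_iff)
    show "p (2 * k - 1) \<noteq> p (2 * k)"
      using permutes_pairs_eq_iff(3)[OF p, of k k] k by auto
  qed
  also have "\<dots> = (\<Prod>i=1..2 * m. \<eta> (p i)) * (\<Prod>k=1..m. a (p (2 * k - 1)) (p (2 * k)))"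
    by (simp add: prod.distrib flip: prod_pairs)
  also have "(\<Prod>i=1..2 * m. \<eta> (p i)) = (\<Prod>i=1..2 * m. \<eta> i)"
    using prod.permute[OF p, of \<eta>] by (simp add: comp_def)
  also have "\<dots> = (\<Prod>i\<in>{s, t}. \<eta> i)"
    using st by (intro prod.mono_neutral_right) (auto simp: \<eta>_def)
  also have "\<dots> = 1" using st \<epsilon> by (simp add: \<eta>_def)
  finally show ?thesis
    using sign_comp_permutes[OF permutes_swap_id[OF st(1,2)] p] st(3)
    by (simp add: pf_term_def sign_swap_id)
qed

section \<open>Moving a pair to the last two points\<close>

text \<open>The cycle on \<open>{r..N}\<close> whose one-line notation has \<open>r\<close> in
  position \<open>N\<close> and the other points in their original order.\<close>

definition move_to :: "nat \<Rightarrow> nat \<Rightarrow> nat \<Rightarrow> nat" where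
  "move_to r N i = (if i = N then r else if r \<le> i \<and> i < N then i + 1 else i)"

lemma move_to_Suc: "r < N \<Longrightarrow> move_to r N = transpose r (Suc r) \<circ> move_to (Suc r) N"
  by (auto simp: move_to_def transpose_def fun_eq_iff)

text \<open>By \<open>move_to_Suc\<close> the cycle is a product of \<open>N - r\<close> adjacent
  transpositions.\<close>

lemma move_to_permutes_sign:
  assumes "r \<le> N"
  shows "move_to r N permutes {r..N} \<and> sign (move_to r N) = (- 1) ^ (N - r)"
  using assms
proof (induction r rule: inc_induct)
  case base
  have "move_to N N = id" by (rule ext) (simp add: move_to_def)
  then show ?case by (simp only: permutes_id sign_id) simp
next
  case (step r)
  have T: "transpose r (Suc r) permutes {r..N}"
    using step by (intro permutes_swap_id) auto
  have M: "move_to (Suc r) N permutes {r..N}"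
    by (rule permutes_subset[of _ "{Suc r..N}"]) (use step in auto)
  have "sign (move_to r N) = - ((- 1) ^ (N - Suc r))"
    using step by (simp add: move_to_Suc sign_comp_permutes[OF T M] sign_swap_id)
  also have "\<dots> = (- 1) ^ (N - r)"
    using step by (metis Suc_diff_Suc power_Suc mult_minus1)
  finally show ?case using step permutes_compose[OF M T] by (simp only: move_to_Suc simp_thms)
qed

text \<open>A pair after \<open>{2 * m + 1, 2 * m + 2}\<close> would start above
  \<open>2 * m + 1\<close> and end above \<open>2 * m + 2\<close>, so this pair comes last and both
  points are fixed. The sets are literally equal because permutations are functions that fix
  everything outside their range.\<close>

lemma pfaffian_perms_last_pair:
  "{p \<in> pfaffian_perms (Suc m). {2 * m + 1, 2 * m + 2} \<in> matching (Suc m) p} = pfaffian_perms m"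
  (is "?L = ?R")
proof (intro equalityI subsetI)
  fix p assume "p \<in> ?L"
  then have p: "p \<in> pfaffian_perms (Suc m)" and "{2 * m + 1, 2 * m + 2} \<in> matching (Suc m) p"
    by auto
  then obtain k where k: "k \<in> {1..Suc m}" and e: "{2 * m + 1, 2 * m + 2} = {p (2 * k - 1), p (2 * k)}"
    by (auto simp: matching_def)
  have perm: "p permutes {1..2 * Suc m}" and mono: "strict_mono_on {1..Suc m} (\<lambda>k. p (2 * k - 1))"
    and lt: "\<And>k. k \<in> {1..Suc m} \<Longrightarrow> p (2 * k - 1) < p (2 * k)"
    using p by (auto simp: pfaffian_perms_def)
  have pk: "p (2 * k - 1) = 2 * m + 1" "p (2 * k) = 2 * m + 2"
    using e lt[OF k] by (auto simp: doubleton_eq_iff)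
  have "k = Suc m"
  proof (rule ccontr)
    assume "k \<noteq> Suc m"
    then have "p (2 * k - 1) < p (2 * Suc m - 1)"
      using strict_mono_onD[OF mono k, of "Suc m"] k by auto
    moreover have "p (2 * Suc m) \<le> 2 * m + 2"
      using permutes_in_image[OF perm, of "2 * Suc m"] by auto
    ultimately show False using lt[of "Suc m"] pk by auto
  qed
  then have last: "p (2 * m + 1) = 2 * m + 1" "p (2 * m + 2) = 2 * m + 2" using pk by (simp_all add: One_nat_def)
  have "p permutes {1..2 * m}"
  proof (rule permutes_superset[OF perm])
    fix i assume "i \<in> {1..2 * Suc m} - {1..2 * m}"
    then have "i = 2 * m + 1 \<or> i = 2 * m + 2" by auto
    then show "p i = i" using last by auto
  qed
  then show "p \<in> ?R"
    using mono lt by (auto simp: pfaffian_perms_def strict_mono_on_def)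
next
  fix p assume p: "p \<in> ?R"
  then have perm: "p permutes {1..2 * m}" by (rule pfaffian_perms_permutes)
  have last: "p (2 * m + 1) = 2 * m + 1" "p (2 * m + 2) = 2 * m + 2"
    using perm by (auto simp: permutes_def)
  have bd: "p (2 * k - 1) < 2 * m + 1" if "k \<in> {1..m}" for k
    using permutes_in_image[OF perm, of "2 * k - 1"] that by auto
  have "p permutes {1..2 * Suc m}"
    by (rule permutes_subset[OF perm]) auto
  moreover have "strict_mono_on {1..Suc m} (\<lambda>k. p (2 * k - 1))"
    using p bd last(1) by (auto simp: pfaffian_perms_def strict_mono_on_def le_Suc_eq simp flip: Suc_eq_plus1)
  moreover have "\<forall>k\<in>{1..Suc m}. p (2 * k - 1) < p (2 * k)"
    using p last by (auto simp: pfaffian_perms_def le_Suc_eq simp flip: Suc_eq_plus1)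
  moreover have "{2 * m + 1, 2 * m + 2} \<in> matching (Suc m) p"
    unfolding matching_def by (rule image_eqI[of _ _ "Suc m"]) (use last in \<open>auto simp flip: Suc_eq_plus1\<close>)
  ultimately show "p \<in> ?L" by (auto simp: pfaffian_perms_def)
qed

text \<open>In normal form every index pair is increasing. This permits replacing an array by its
  antisymmetric extension.\<close>

lemma pfaffian_cong:
  assumes "\<And>i j. 1 \<le> i \<Longrightarrow> i < j \<Longrightarrow> j \<le> 2 * m \<Longrightarrow> a i j = b i j"
  shows "pfaffian m a = pfaffian m b"
proof -
  have "a (p (2 * k - 1)) (p (2 * k)) = b (p (2 * k - 1)) (p (2 * k))"
    if "p \<in> pfaffian_perms m" "k \<in> {1..m}" for p k
    using that permutes_in_image[OF pfaffian_perms_permutes[OF that(1)], of "2 * k"]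
      permutes_in_image[OF pfaffian_perms_permutes[OF that(1)], of "2 * k - 1"]
    by (intro assms) (auto simp: pfaffian_perms_def)
  then show ?thesis
    unfolding pfaffian_def by (intro sum.cong prod.cong arg_cong2[where f = "(*)"]) auto
qed

section \<open>Pfaffians with two proportional rows\<close>

text \<open>Covers adjacent and cyclic positions at once through \<epsilon>. On
  \<open>{1..2 * m}\<close> the map \<open>e\<close> lists the points other than \<open>u\<close>
  and \<open>v\<close> increasingly, so the Pfaffian on the right is that of the array with rows and
  columns \<open>u\<close>, \<open>v\<close> deleted.\<close>

lemma pfaffian_proportional_rows:
  fixes a :: "nat \<Rightarrow> nat \<Rightarrow> 'a::field" and u v m :: nat
  assumes two: "(2 :: 'a) \<noteq> 0"
    and anti: "\<And>i j. i \<noteq> j \<Longrightarrow> a i j = - a j i"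
    and \<epsilon>: "\<epsilon> * \<epsilon> = 1"
    and a: "\<And>j. j \<in> {1..2 * Suc m} - {u, v} \<Longrightarrow> a v j = \<epsilon> * a u j"
    and uv: "1 \<le> u" "u < v" "v \<le> 2 * Suc m" "odd (u + v)"
  defines "e \<equiv> move_to v (2 * m + 2) \<circ> move_to u (2 * m + 1)"
  shows "pfaffian (Suc m) a = a u v * pfaffian m (\<lambda>i j. a (e i) (e j))"
proof -
  let ?S = "{1..2 * Suc m}" and ?P = "pfaffian_perms (Suc m)" and ?M = "matching (Suc m)"
  let ?w = "pf_term (Suc m) a" and ?T = "transpose u v"
  \<comment> \<open>\<open>F\<close> collects the matchings that do not pair \<open>u\<close> with
    \<open>v\<close>, \<open>G\<close> those that do; both depend on the matching only.\<close>
  define F where "F p = (if {u, v} \<in> ?M p then 0 else ?w p)" for p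
  define G where "G p = (if {u, v} \<in> ?M p then ?w p else 0)" for p
  have FG: "F p = F q" "G p = G q" if "p permutes ?S" "q permutes ?S" "?M p = ?M q" for p q
    unfolding F_def G_def using pf_term_cong_matching[of a, OF anti that] that(3) by simp_all
  have T: "?T permutes ?S" using uv by (intro permutes_swap_id) auto
  have neg: "F (?T \<circ> p) = - F p" if p: "p \<in> ?P" for p
  proof -
    have "{u, v} \<in> ?M (?T \<circ> p) \<longleftrightarrow> {u, v} \<in> ?M p"
    proof -
      have "?T ` {u, v} = {u, v}" by auto
      then show ?thesis
        using image_mem_matching_comp_iff[OF permutes_inj[OF T], of "{u, v}" "Suc m" p] by simp
    qed
    moreover have "?w (?T \<circ> p) = - ?w p" if "{u, v} \<notin> ?M p"
      by (rule pf_term_transpose[where \<epsilon> = \<epsilon>, OF anti \<epsilon> a _ _ _ pfaffian_perms_permutes[OF p] that])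
        (use uv in auto)
    ultimately show ?thesis by (simp add: F_def)
  qed
  have "(\<Sum>p\<in>?P. F p) = (\<Sum>p\<in>?P. F (?T \<circ> p))"
    using sum_pfaffian_perms_comp[where F = F, OF T FG(1)] by (rule sym)
  also have "\<dots> = - (\<Sum>p\<in>?P. F p)"
    unfolding sum_negf[symmetric] by (rule sum.cong[OF refl neg])
  finally have "2 * (\<Sum>p\<in>?P. F p) = 0" by (simp only: mult_2 eq_neg_iff_add_eq_0)
  then have F0: "(\<Sum>p\<in>?P. F p) = 0" using two by simp
  have e1: "move_to u (2 * m + 1) permutes ?S"
    by (rule permutes_subset[of _ "{u..2 * m + 1}"]) (use uv move_to_permutes_sign in auto)
  have e2: "move_to v (2 * m + 2) permutes ?S"
    by (rule permutes_subset[of _ "{v..2 * m + 2}"]) (use uv move_to_permutes_sign in auto)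
  have e: "e permutes ?S" unfolding e_def by (rule permutes_compose[OF e1 e2])
  \<comment> \<open>The outer cycle fixes \<open>u\<close> because \<open>u < v\<close>, and the
    inner one fixes \<open>2 * m + 2\<close>.\<close>
  have eu: "e (2 * m + 1) = u" and ev: "e (2 * m + 2) = v"
    using uv by (auto simp: e_def move_to_def)
  have sign_uv: "sign (move_to u (2 * m + 1)) = (- 1) ^ (2 * m + 1 - u)"
    "sign (move_to v (2 * m + 2)) = (- 1) ^ (2 * m + 2 - v)"
    using uv by (auto intro!: conjunct2[OF move_to_permutes_sign])
  have "sign e = (- 1) ^ (2 * m + 2 - v + (2 * m + 1 - u))"
    unfolding e_def sign_comp_permutes[OF e2 e1 finite_atLeastAtMost]
    by (simp only: sign_uv power_add)
  \<comment> \<open>The exponent is \<open>4 * m + 3 - (u + v)\<close>, with \<open>u + v\<close>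
    odd.\<close>
  moreover have "even (2 * m + 2 - v + (2 * m + 1 - u))" using uv by presburger
  ultimately have sign_e: "sign e = 1" by (simp only: power_minus1_even neg_one_even_power)
  have "pfaffian (Suc m) a = (\<Sum>p\<in>?P. F p + G p)"
    unfolding pfaffian_eq_sum_pf_term by (rule sum.cong) (simp_all add: F_def G_def)
  also have "\<dots> = (\<Sum>p\<in>?P. G p)" by (simp only: sum.distrib F0 add_0_left)
  also have "\<dots> = (\<Sum>p\<in>?P. G (e \<circ> p))"
    using sum_pfaffian_perms_comp[where F = G, OF e FG(2)] by (rule sym)
  also have "\<dots> = (\<Sum>p\<in>?P. if {2 * m + 1, 2 * m + 2} \<in> ?M p then ?w (e \<circ> p) else 0)"
  proof (intro sum.cong refl)
    fix p
    have "{u, v} = e ` {2 * m + 1, 2 * m + 2}" using eu ev by auto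
    then have "{u, v} \<in> ?M (e \<circ> p) \<longleftrightarrow> {2 * m + 1, 2 * m + 2} \<in> ?M p"
      by (simp only: image_mem_matching_comp_iff[OF permutes_inj[OF e]])
    then show "G (e \<circ> p) = (if {2 * m + 1, 2 * m + 2} \<in> ?M p then ?w (e \<circ> p) else 0)"
      by (simp add: G_def)
  qed
  also have "\<dots> = (\<Sum>p\<in>pfaffian_perms m. ?w (e \<circ> p))"
    by (subst sum.inter_filter[symmetric]) (simp_all only: finite_pfaffian_perms pfaffian_perms_last_pair)
  also have "\<dots> = (\<Sum>p\<in>pfaffian_perms m. a u v * pf_term m (\<lambda>i j. a (e i) (e j)) p)"
  proof (intro sum.cong refl)
    fix p assume "p \<in> pfaffian_perms m"
    then have p: "p permutes {1..2 * m}" by (rule pfaffian_perms_permutes)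
    then have p': "p permutes ?S" by (rule permutes_subset) auto
    \<comment> \<open>The factor for the last pair is therefore \<open>a u v\<close>, and composing
      with the even \<open>e\<close> keeps the sign.\<close>
    have "p (2 * m + 1) = 2 * m + 1" "p (2 * m + 2) = 2 * m + 2"
      using p by (auto simp: permutes_def)
    then show "?w (e \<circ> p) = a u v * pf_term m (\<lambda>i j. a (e i) (e j)) p"
      using sign_comp_permutes[OF e p'] sign_e eu ev by (simp add: pf_term_def flip: Suc_eq_plus1)
  qed
  finally show ?thesis by (simp add: pfaffian_eq_sum_pf_term sum_distrib_left)
qed

section \<open>Equal cyclically adjacent arguments\<close>

lemma pf_map_upt:
  "pf \<psi> (map y [1..<2 * m + 1]) = pfaffian m (\<lambda>i j. \<psi> (y i) (y j))"
  by (auto simp: pf_def simp del: upt_Suc intro!: pfaffian_cong)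

theorem theorem1p2:
  fixes \<psi> :: "'a::field \<Rightarrow> 'a \<Rightarrow> 'a"
    and x :: "nat \<Rightarrow> 'a"
    and n s t :: nat
  assumes char: "CHAR('a) \<noteq> 2"
    and sym: "\<And>a b. \<psi> a b = \<psi> b a"
    and transl: "\<And>a b z. \<psi> (a + z) (b + z) = \<psi> a b"
    and n: "n \<ge> 1"
    and s: "1 \<le> s" "s \<le> 2 * n"
    and t: "t = (if s = 2 * n then 1 else s + 1)"
  shows "pf \<psi> (map (x(t := x s)) [1..<2 * n + 1])
       = \<psi> 0 0 * pf \<psi> (map x [i \<leftarrow> [1..<2 * n + 1]. i \<noteq> s \<and> i \<noteq> t])"
proof -
  obtain m where m: "n = Suc m" using n by (cases n) auto
  define y where "y = x(t := x s)"
  define u v where "u = min s t" and "v = max s t"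
  define a where "a i j = (if i < j then \<psi> (y i) (y j) else - \<psi> (y i) (y j))" for i j
  \<comment> \<open>For adjacent positions any other index lies on the same side of both; for the
    first and last position it lies above one and below the other, which flips the sign in
    \<open>a\<close>.\<close>
  define \<epsilon> :: 'a where "\<epsilon> = (if s = 2 * n then - 1 else 1)"
  define e where "e = move_to v (2 * m + 2) \<circ> move_to u (2 * m + 1)"
  \<comment> \<open>The sum \<open>u + v\<close> is \<open>2 * s + 1\<close> or, in the cyclic case,
    \<open>2 * n + 1\<close>.\<close>
  have uv: "1 \<le> u" "u < v" "v \<le> 2 * Suc m" "odd (u + v)" and uv_st: "{u, v} = {s, t}"
    using s t m by (auto simp: u_def v_def min_def max_def)
  have y_uv: "y u = x s" "y v = x s" using uv_st by (auto simp: y_def doubleton_eq_iff)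
  have y_x: "y i = x i" if "i \<noteq> u" "i \<noteq> v" for i
    using that uv_st by (auto simp: y_def)
  have two: "(2 :: 'a) \<noteq> 0"
  proof
    assume "(2 :: 'a) = 0"
    then have "CHAR('a) dvd 2" using of_nat_eq_0_iff_char_dvd[of 2, where 'a = 'a] by simp
    moreover from this have "CHAR('a) \<noteq> 0" by (metis dvd_0_left_iff zero_neq_numeral)
    moreover have "CHAR('a) \<noteq> 1" using CHAR_not_1 by (simp add: One_nat_def)
    ultimately show False using char dvd_imp_le[of "CHAR('a)" 2] by linarith
  qed
  have e_less: "e i < e j" if "i < j" "j \<le> 2 * m" for i j
    using that by (auto simp: e_def move_to_def)
  have "pf \<psi> (map y [1..<2 * n + 1]) = pfaffian (Suc m) a"
    unfolding pf_map_upt m by (rule pfaffian_cong) (simp add: a_def)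
  also have "\<dots> = a u v * pfaffian m (\<lambda>i j. a (e i) (e j))"
    unfolding e_def
  proof (rule pfaffian_proportional_rows[where \<epsilon> = \<epsilon>, OF two _ _ _ uv])
    show "a i j = - a j i" if "i \<noteq> j" for i j using that sym[of "y i"] by (auto simp: a_def)
    show "\<epsilon> * \<epsilon> = 1" by (simp add: \<epsilon>_def)
    show "a v j = \<epsilon> * a u j" if "j \<in> {1..2 * Suc m} - {u, v}" for j
      using that y_uv s t m by (auto simp: a_def \<epsilon>_def u_def v_def)
  qed
  \<comment> \<open>Both arguments equal \<open>x s\<close>; translation by \<open>x s\<close>
    relates this to the value at zero.\<close>
  also have "a u v = \<psi> 0 0"
    using transl[of 0 "x s" 0] uv y_uv by (simp add: a_def)
  also have "pfaffian m (\<lambda>i j. a (e i) (e j)) = pfaffian m (\<lambda>i j. \<psi> (x (e i)) (x (e j)))"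
  proof (rule pfaffian_cong)
    fix i j assume ij: "1 \<le> i" "i < j" "j \<le> 2 * m"
    \<comment> \<open>On these indices \<open>e\<close> avoids \<open>u\<close> and
      \<open>v\<close>, where alone \<open>y\<close> might differ from \<open>x\<close>.\<close>
    have "e k \<noteq> u" "e k \<noteq> v" if "k \<le> 2 * m" for k
      using that uv by (auto simp: e_def move_to_def split: if_splits)
    then show "a (e i) (e j) = \<psi> (x (e i)) (x (e j))"
      using ij e_less[of i j] by (simp add: a_def y_x)
  qed
  also have "\<dots> = pf \<psi> (map x (map e [1..<2 * m + 1]))"
    using pf_map_upt[of \<psi> "x \<circ> e" m] by simp
  also have "map e [1..<2 * m + 1] = [i \<leftarrow> [1..<2 * n + 1]. i \<noteq> s \<and> i \<noteq> t]"
  proof -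
    have "e ` {1..2 * m} = {1..2 * n} - {u, v}"
    proof (intro equalityI subsetI)
      fix i assume i: "i \<in> {1..2 * n} - {u, v}"
      \<comment> \<open>The inverse of \<open>e\<close>: subtract the number of deleted positions
        below \<open>i\<close>.\<close>
      have "i = e (if i < u then i else if i < v then i - 1 else i - 2)"
        using i uv m by (auto simp: e_def move_to_def)
      moreover have "(if i < u then i else if i < v then i - 1 else i - 2) \<in> {1..2 * m}"
        using i uv m by auto
      ultimately show "i \<in> e ` {1..2 * m}" by (rule image_eqI)
    qed (use uv m in \<open>auto simp: e_def move_to_def split: if_splits\<close>)
    moreover have "strict_mono_on {1..2 * m} e"
      using e_less by (simp add: strict_mono_on_def)
    ultimately have "map e [1..<2 * m + 1] = sorted_list_of_set ({1..2 * n} - {s, t})"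
      using uv_st by (simp only: map_upt_eq_sorted_list_of_set)
    also have "\<dots> = [i \<leftarrow> [1..<2 * n + 1]. i \<noteq> s \<and> i \<noteq> t]"
      by (rule sorted_distinct_set_unique) (auto intro: sorted_wrt_filter simp del: upt_Suc)
    finally show ?thesis .
  qed
  finally show ?thesis unfolding y_def .
qed

end
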